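(* Let $\Gamma$ and $\Gamma'$ be graphs, let $f:\Gamma\to\Gamma'$ be a morphism of graphs, and let $(X,p,\Gamma')$ be an $F$-graph bundle (for some graph $F$), with pullback $(f^*X, f^*p,\Gamma)$ along $f$. Then there is a morphism of graphs $\mathcal F: f^*X\to X$ such that $p\circ\mathcal F = f\circ f^*p$.
   Context: Graphs are simple and undirected: $\Gamma=(V_\Gamma,E_\Gamma)$ with $E_\Gamma$ a set of unordered pairs of distinct vertices; $v\sim w$ means $\{v,w\}\in E_\Gamma$. A morphism of graphs $f:\Gamma_1\to\Gamma_2$ is a function $f:V_{\Gamma_1}\to V_{\Gamma_2}$ such that $v\sim w$ implies $f(v)\sim f(w)$ or $f(v)=f(w)$; it is surjective if it is surjective on vertices. An isomorphism of graphs is a bijection on vertices with $v\sim w$ iff $f(v)\sim f(w)$. The neighborhood $N(v)$ of a vertex $v$ is the graph with vertices $v$ and all $w\sim v$, and edges $\{v,w\}$ for $w\sim v$. For a natural number $k$, a triple $(\widetilde\Gamma,p,\Gamma)$ with $p:\widetilde\Gamma\to\Gamma$ a surjective morphism of graphs is a $k$-fold covering if each $p^{-1}(v)$ has exactly $k$ vertices and, for each vertex $x$ of $\widetilde\Gamma$, $p$ restricts to an isomorphism $N(x)\to N(p(x))$. For $v\sim w$ in $\Gamma$ the covering induces a bijection $\psi_{vw}:p^{-1}(v)\to p^{-1}(w)$ sending $x$ to the unique neighbour of $x$ in $\widetilde\Gamma$ lying over $w$. Graph bundles. Let $p:X\to\Gamma$ be a surjective morphism of graphs. The fiber $p^{-1}(v)$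 is the subgraph of $X$ induced on the preimage of $v$. Let $\widetilde X$ be the graph with vertex set $V_X$ whose edges are the edges $\{x,y\}$ of $X$ with $p(x)\ne p(y)$, and let $\widetilde p:\widetilde X\to\Gamma$ be the map $p$. Given a graph $F$, $(X,p,\Gamma)$ is an $F$-graph bundle if (1) each fiber $p^{-1}(v)$ is isomorphic to $F$; (2) $\widetilde p:\widetilde X\to\Gamma$ is a $|V_F|$-fold covering; (3) for all $v\sim w$ in $\Gamma$ the bijection $\psi_{vw}:p^{-1}(v)\to p^{-1}(w)$ induced by this covering is an isomorphism of graphs. Pullback. For a morphism $f:\Gamma\to\Gamma'$ and an $F$-graph bundle $(X,p,\Gamma')$, the pullback $f^*(X,p,\Gamma')=(f^*X,f^*p,\Gamma)$ has $V_{f^*X}=\{(v,x)\in V_\Gamma\times V_X: f(v)=p(x)\}$, with $(v,x)\sim(w,y)$ iff one of: (I) $v=w$ and $x\sim y$; (II) $v\sim w$, $f(v)=f(w)$ and $x=y$; (III) $v\sim w$, $f(v)\sim f(w)$ and $x\sim y$. The projection is $f^*p(v,x)=v$. *)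

theory Defs
  imports "HOL-Library.FuncSet"
begin

text \<open>
  Graphs are simple and undirected, of arbitrary cardinality. A map between graphs is a HOL
  function on the ambient vertex types; only its values on the vertex set matter.
\<close>

record 'a ugraph =
  verts :: "'a set"
  edges :: "'a set set"

definition simple_graph :: "'a ugraph \<Rightarrow> bool" where
  "simple_graph G \<longleftrightarrow>
     (\<forall>e\<in>edges G. \<exists>v w. v \<in> verts G \<and> w \<in> verts G \<and> v \<noteq> w \<and> e = {v, w})"

definition adj :: "'a ugraph \<Rightarrow> 'a \<Rightarrow> 'a \<Rightarrow> bool" where
  "adj G v w \<longleftrightarrow> {v, w} \<in> edges G"

definition graph_morphism :: "'a ugraph \<Rightarrow> 'b ugraph \<Rightarrow> ('a \<Rightarrow> 'b) \<Rightarrow> bool" where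
  "graph_morphism G H f \<longleftrightarrow>
     simple_graph G \<and> simple_graph H \<and> f \<in> verts G \<rightarrow> verts H \<and>
     (\<forall>v\<in>verts G. \<forall>w\<in>verts G. adj G v w \<longrightarrow> adj H (f v) (f w) \<or> f v = f w)"

definition surj_graph_morphism :: "'a ugraph \<Rightarrow> 'b ugraph \<Rightarrow> ('a \<Rightarrow> 'b) \<Rightarrow> bool" where
  "surj_graph_morphism G H f \<longleftrightarrow> graph_morphism G H f \<and> f ` verts G = verts H"

definition graph_isomorphism :: "'a ugraph \<Rightarrow> 'b ugraph \<Rightarrow> ('a \<Rightarrow> 'b) \<Rightarrow> bool" where
  "graph_isomorphism G H f \<longleftrightarrow>
     simple_graph G \<and> simple_graph H \<and> bij_betw f (verts G) (verts H) \<and>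
     (\<forall>v\<in>verts G. \<forall>w\<in>verts G. adj G v w \<longleftrightarrow> adj H (f v) (f w))"

text \<open>The neighborhood is a star: it is in general not the induced subgraph.\<close>

definition neighborhood :: "'a ugraph \<Rightarrow> 'a \<Rightarrow> 'a ugraph" where
  "neighborhood G v =
     \<lparr>verts = insert v {w. adj G v w}, edges = {{v, w} | w. adj G v w}\<rparr>"

definition induced_subgraph :: "'a ugraph \<Rightarrow> 'a set \<Rightarrow> 'a ugraph" where
  "induced_subgraph G S = \<lparr>verts = verts G \<inter> S, edges = {e \<in> edges G. e \<subseteq> S}\<rparr>"

definition fiber_verts :: "'a ugraph \<Rightarrow> ('a \<Rightarrow> 'b) \<Rightarrow> 'b \<Rightarrow> 'a set" where
  "fiber_verts X p v = {x \<in> verts X. p x = v}"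

definition fiber :: "'a ugraph \<Rightarrow> ('a \<Rightarrow> 'b) \<Rightarrow> 'b \<Rightarrow> 'a ugraph" where
  "fiber X p v = induced_subgraph X (fiber_verts X p v)"

definition fold_covering :: "nat \<Rightarrow> 'a ugraph \<Rightarrow> ('a \<Rightarrow> 'b) \<Rightarrow> 'b ugraph \<Rightarrow> bool" where
  "fold_covering k Y p G \<longleftrightarrow>
     surj_graph_morphism Y G p \<and>
     (\<forall>v\<in>verts G. finite (fiber_verts Y p v) \<and> card (fiber_verts Y p v) = k) \<and>
     (\<forall>x\<in>verts Y. graph_isomorphism (neighborhood Y x) (neighborhood G (p x)) p)"

text \<open>
  The map \<open>\<psi>\<^sub>v\<^sub>w\<close> from the fiber over \<open>v\<close> to the fiber over \<open>w\<close>. The description is meaningful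
  when \<open>p\<close> is a covering and \<open>v\<close>, \<open>w\<close> are adjacent.
\<close>

definition fiber_transport :: "'a ugraph \<Rightarrow> ('a \<Rightarrow> 'b) \<Rightarrow> 'b \<Rightarrow> 'b \<Rightarrow> 'a \<Rightarrow> 'a" where
  "fiber_transport Y p v w =
     (\<lambda>x\<in>fiber_verts Y p v. THE y. y \<in> fiber_verts Y p w \<and> adj Y x y)"

text \<open>The graph \<open>X\<close> with all edges inside fibers of \<open>p\<close> removed.\<close>

definition horizontal_graph :: "'a ugraph \<Rightarrow> ('a \<Rightarrow> 'b) \<Rightarrow> 'a ugraph" where
  "horizontal_graph X p =
     \<lparr>verts = verts X, edges = {{x, y} | x y. {x, y} \<in> edges X \<and> p x \<noteq> p y}\<rparr>"

text \<open>
  Coverings are \<open>k\<close>-fold for a natural number \<open>k\<close>, so that \<open>F\<close> has to be finite; the finiteness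
  is explicit because \<^const>\<open>card\<close> is \<open>0\<close> on infinite sets.
\<close>

definition graph_bundle ::
  "'f ugraph \<Rightarrow> 'a ugraph \<Rightarrow> ('a \<Rightarrow> 'b) \<Rightarrow> 'b ugraph \<Rightarrow> bool" where
  "graph_bundle F X p G \<longleftrightarrow>
     simple_graph F \<and> finite (verts F) \<and>
     surj_graph_morphism X G p \<and>
     (\<forall>v\<in>verts G. \<exists>h. graph_isomorphism (fiber X p v) F h) \<and>
     fold_covering (card (verts F)) (horizontal_graph X p) p G \<and>
     (\<forall>v\<in>verts G. \<forall>w\<in>verts G. adj G v w \<longrightarrow>
        graph_isomorphism (fiber X p v) (fiber X p w)
          (fiber_transport (horizontal_graph X p) p v w))"

definition pullback_verts ::
  "'a ugraph \<Rightarrow> ('a \<Rightarrow> 'b) \<Rightarrow> 'c ugraph \<Rightarrow> ('c \<Rightarrow> 'b) \<Rightarrow> ('a \<times> 'c) set" where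
  "pullback_verts G f X p = {(v, x). v \<in> verts G \<and> x \<in> verts X \<and> f v = p x}"

definition pullback_graph ::
  "'a ugraph \<Rightarrow> ('a \<Rightarrow> 'b) \<Rightarrow> 'b ugraph \<Rightarrow> 'c ugraph \<Rightarrow> ('c \<Rightarrow> 'b) \<Rightarrow> ('a \<times> 'c) ugraph" where
  "pullback_graph G f G' X p =
     \<lparr>verts = pullback_verts G f X p,
      edges = {{(v, x), (w, y)} | v x w y.
        (v, x) \<in> pullback_verts G f X p \<and> (w, y) \<in> pullback_verts G f X p \<and>
        (v = w \<and> adj X x y \<or>
         adj G v w \<and> f v = f w \<and> x = y \<or>
         adj G v w \<and> adj G' (f v) (f w) \<and> adj X x y)}\<rparr>"

definition pullback_proj :: "'a \<times> 'c \<Rightarrow> 'a" where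
  "pullback_proj = (\<lambda>(v, x). v)"

end

theory Submission imports Defs begin

text \<open>The witness is the second projection \<open>snd\<close>. A vertex \<open>(v, x)\<close>
  of the pullback satisfies \<open>f v = p x\<close>, which is exactly commutativity of the square.
  An edge of kind (I) or (III) projects to an edge of \<open>X\<close>, and one of kind (II)
  collapses to a vertex, as a morphism may do. \<open>adj_pullback_graph_iff\<close> makes this case
  split available, and \<open>simple_graph_pullback_graph\<close> shows that the pullback is a
  graph.\<close>

lemma simple_graph_adjD:
  assumes "simple_graph G" "adj G v w"
  shows "v \<noteq> w"
  using assms unfolding simple_graph_def adj_def by (metis doubleton_eq_iff)

text \<open>An unordered pair can be listed in either order, but the edge condition is symmetric
  under exchanging \<open>(v, x)\<close> and \<open>(w, y)\<close>.\<close>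

lemma adj_pullback_graph_iff:
  "adj (pullback_graph G f G' X p) (v, x) (w, y) \<longleftrightarrow>
     (v, x) \<in> pullback_verts G f X p \<and> (w, y) \<in> pullback_verts G f X p \<and>
     (v = w \<and> adj X x y \<or>
      adj G v w \<and> f v = f w \<and> x = y \<or>
      adj G v w \<and> adj G' (f v) (f w) \<and> adj X x y)"
  unfolding adj_def pullback_graph_def
  by (auto simp: doubleton_eq_iff insert_commute)

text \<open>There are no loops: along every edge some coordinate moves along an edge of a simple
  graph, \<open>x\<close> in kind (I) and \<open>v\<close> in kinds (II) and (III).\<close>

lemma simple_graph_pullback_graph:
  assumes "simple_graph G" "simple_graph X"
  shows "simple_graph (pullback_graph G f G' X p)"
  unfolding simple_graph_def
proof
  fix e assume e: "e \<in> edges (pullback_graph G f G' X p)"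
  then obtain v x w y where vw: "e = {(v, x), (w, y)}"
    unfolding pullback_graph_def by auto
  with e have "adj (pullback_graph G f G' X p) (v, x) (w, y)"
    by (simp add: adj_def)
  then have "(v, x) \<in> pullback_verts G f X p" "(w, y) \<in> pullback_verts G f X p"
    and "(v, x) \<noteq> (w, y)"
    using simple_graph_adjD[OF assms(1)] simple_graph_adjD[OF assms(2)]
    unfolding adj_pullback_graph_iff by blast+
  with vw show "\<exists>a b. a \<in> verts (pullback_graph G f G' X p) \<and>
      b \<in> verts (pullback_graph G f G' X p) \<and> a \<noteq> b \<and> e = {a, b}"
    unfolding pullback_graph_def by auto
qed

lemma graph_morphism_pullback_snd:
  assumes "simple_graph G" "simple_graph X"
  shows "graph_morphism (pullback_graph G f G' X p) X snd"
proof -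
  have "snd \<in> verts (pullback_graph G f G' X p) \<rightarrow> verts X"
    by (auto simp: pullback_graph_def pullback_verts_def)
  then show ?thesis
    using simple_graph_pullback_graph[OF assms] assms(2)
    by (auto simp: graph_morphism_def adj_pullback_graph_iff)
qed

theorem theorem3p10:
  fixes \<Gamma> :: "'a ugraph" and \<Gamma>' :: "'b ugraph" and X :: "'c ugraph" and F :: "'d ugraph"
    and f :: "'a \<Rightarrow> 'b" and p :: "'c \<Rightarrow> 'b"
  assumes "simple_graph \<Gamma>" and "simple_graph \<Gamma>'"
    and "graph_morphism \<Gamma> \<Gamma>' f"
    and "graph_bundle F X p \<Gamma>'"
  shows "\<exists>\<F> :: 'a \<times> 'c \<Rightarrow> 'c.
    graph_morphism (pullback_graph \<Gamma> f \<Gamma>' X p) X \<F> \<and>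
    (\<forall>z\<in>verts (pullback_graph \<Gamma> f \<Gamma>' X p). (p \<circ> \<F>) z = (f \<circ> pullback_proj) z)"
\<comment> \<open>The witness stays schematic until the first \<open>show\<close> fixes it as
  \<open>snd\<close>.\<close>
proof (intro exI conjI)
  have "simple_graph X"
    using assms(4) by (simp add: graph_bundle_def surj_graph_morphism_def graph_morphism_def)
  with assms(1) show "graph_morphism (pullback_graph \<Gamma> f \<Gamma>' X p) X snd"
    by (rule graph_morphism_pullback_snd)
  show "\<forall>z\<in>verts (pullback_graph \<Gamma> f \<Gamma>' X p). (p \<circ> snd) z = (f \<circ> pullback_proj) z"
    by (auto simp: pullback_graph_def pullback_verts_def pullback_proj_def)
qed

end
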